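(* For any $c\in W_{D_4^{(3)}}^0=\mathcal C_6^g$, we have $$L_{D_4^{(3)}}(c)=L_{A_5^{(2)}}(c)-a_3^{A_5^{(2)}}(c)=\frac12\big(L(c)-a_0(c)-a_3(c)\big).$$
   Context: A $6$-core is a partition having no hook length equal to $6$; $\mathcal C_6$ is the set of $6$-cores. The box in row $i$, column $j$ has residue $(j-i)\bmod 6$; boxes of residue $i$ are $i$-nodes; $L(c)$ is the number of boxes of $c$ and $a_i(c)$ its number of $i$-nodes. The affine Weyl group $\widetilde{\mathfrak S}_6$ of type $A_5^{(1)}$, with simple reflections $s_0,\dots,s_5$, acts on $\mathcal C_6$: $s_i\cdot c$ is obtained by removing all removable $i$-nodes of $c$ if there are some, adding all addable $i$-nodes if there are some, and $s_i\cdot c=c$ otherwise. A $6$-core $c$ is determined by the vector $\beta\in\mathbb Z^6$, $\beta_i=a_{i-1}(c)-a_{i\bmod 6}(c)$, $1\le i\le 6$. $\mathcal C_6^g$ is the set of $6$-cores whose vector is of the form $(\beta_1,\beta_2,\beta_1-\beta_2,\beta_2-\beta_1,-\beta_2,-\beta_1)$. Let $\alpha_0,\dots,\alpha_5$, $\Lambda_0,\dots,\Lambda_5$ be the simple roots and fundamental weights of type $A_5^{(1)}$, with $\widetilde{\mathfrak S}_6$ acting by $s_i(x)=x-\langle x,\alpha_i^\vee\rangle\alpha_i$. Type $A_5^{(2)}$ is realized by $\alpha_0^{A_5^{(2)}}=2\alpha_0+\alpha_1+\alpha_5$, $\alpha_1^{A_5^{(2)}}=\alpha_1+\alpha_5$,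 $\alpha_2^{A_5^{(2)}}=\alpha_2+\alpha_4$, $\alpha_3^{A_5^{(2)}}=2\alpha_3$, $\Lambda_0^{A_5^{(2)}}=\Lambda_0$, with Weyl group $\langle s_0s_1s_5s_0,\,s_1s_5,\,s_2s_4,\,s_3\rangle$. Type $D_4^{(3)}$ is realized by $\alpha_0^{D_4^{(3)}}=\alpha_0^{A_5^{(2)}}$, $\alpha_1^{D_4^{(3)}}=\alpha_2^{A_5^{(2)}}$, $\alpha_2^{D_4^{(3)}}=\alpha_1^{A_5^{(2)}}+\alpha_3^{A_5^{(2)}}$, $\Lambda_0^{D_4^{(3)}}=\Lambda_0^{A_5^{(2)}}$, with Weyl group $W_{D_4^{(3)}}=\langle s_0s_1s_5s_0,\,s_2s_4,\,s_1s_3s_5\rangle$. The affine Grassmannian $W_{D_4^{(3)}}^0$ (minimal length representatives of left cosets modulo $\langle s_2s_4,s_1s_3s_5\rangle$) is identified with $\mathcal C_6^g$ via $w\mapsto w\cdot\varnothing$. For $X\in\{A_5^{(2)},D_4^{(3)}\}$ and $w$ in the Weyl group of type $X$ with $c=w\cdot\varnothing$, write $\Lambda_0^X-w(\Lambda_0^X)=\sum_i a_i^X(c)\alpha_i^X$ (this depends only on $c$); the atomic length is $L_X(c)=\sum_i a_i^X(c)$. *)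

theory Defs
  imports "HOL-Analysis.Analysis" "HOL-Algebra.Bij" "HOL-Algebra.Generated_Groups"
begin

text \<open>Partitions are represented by their Young diagrams. Rows and columns are numbered from 0;
  this does not change the residue of a box, which is taken in the ring \<^typ>\<open>6\<close> of integers
  modulo 6.\<close>

type_synonym diagram = "(nat \<times> nat) set"

definition is_partition :: "diagram \<Rightarrow> bool" where
  "is_partition c \<longleftrightarrow> finite c \<and> (\<forall>i j i' j'. (i, j) \<in> c \<longrightarrow> i' \<le> i \<longrightarrow> j' \<le> j \<longrightarrow> (i', j') \<in> c)"

definition hook :: "diagram \<Rightarrow> nat \<Rightarrow> nat \<Rightarrow> (nat \<times> nat) set" where
  "hook c i j = {(i, j') | j'. j \<le> j' \<and> (i, j') \<in> c} \<union> {(i', j) | i'. i \<le> i' \<and> (i', j) \<in> c}"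

definition cores6 :: "diagram set" where
  "cores6 = {c. is_partition c \<and> (\<forall>(i, j) \<in> c. card (hook c i j) \<noteq> 6)}"

definition residue :: "nat \<times> nat \<Rightarrow> 6" where
  "residue b = of_nat (snd b) - of_nat (fst b)"

definition node_count :: "6 \<Rightarrow> diagram \<Rightarrow> nat" where
  "node_count i c = card {b \<in> c. residue b = i}"

definition removable :: "6 \<Rightarrow> diagram \<Rightarrow> diagram" where
  "removable i c = {b \<in> c. residue b = i \<and> is_partition (c - {b})}"

definition addable :: "6 \<Rightarrow> diagram \<Rightarrow> diagram" where
  "addable i c = {b. b \<notin> c \<and> residue b = i \<and> is_partition (insert b c)}"

text \<open>A core never has both addable and removable \<open>i\<close>-nodes, so the order of the two cases is
  immaterial. If there are neither, the diagram is left unchanged.\<close>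

definition core_refl :: "6 \<Rightarrow> diagram \<Rightarrow> diagram" where
  "core_refl i c = (if removable i c \<noteq> {} then c - removable i c else c \<union> addable i c)"

text \<open>The entry \<open>\<beta>\<^sub>k\<close> for \<open>1 \<le> k \<le> 6\<close>; note that \<^term>\<open>of_nat 6 = (0 :: 6)\<close>.\<close>

definition core_vector :: "diagram \<Rightarrow> nat \<Rightarrow> int" where
  "core_vector c k = int (node_count (of_nat (k - 1)) c) - int (node_count (of_nat k) c)"

definition cores6_g :: "diagram set" where
  "cores6_g = {c \<in> cores6. \<exists>b1 b2 :: int.
     map (core_vector c) [1, 2, 3, 4, 5, 6] = [b1, b2, b1 - b2, b2 - b1, - b2, - b1]}"

text \<open>The weight space of type \<open>A\<^sub>5\<^sup>(\<^sup>1\<^sup>)\<close>, with basis the fundamental weights \<open>\<Lambda>\<^sub>0, \<dots>, \<Lambda>\<^sub>5\<close> and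
  the null root \<open>\<delta> = \<alpha>\<^sub>0 + \<dots> + \<alpha>\<^sub>5\<close>: the pair \<open>(v, t)\<close> stands for \<open>\<Sum>i. v\<^sub>i \<Lambda>\<^sub>i + t \<delta>\<close>. As
  \<open>\<delta>\<close> pairs to zero with every simple coroot, the pairing of \<open>x\<close> with the \<open>i\<close>-th simple coroot is
  \<open>fst x $ i\<close>.\<close>

type_synonym weight = "(real ^ 6) \<times> real"

definition fund_weight :: "6 \<Rightarrow> weight" where
  "fund_weight i = (axis i 1, 0)"

text \<open>The first component is the \<open>i\<close>-th column of the Cartan matrix; the \<open>\<delta>\<close> in \<open>\<alpha>\<^sub>0\<close> makes the
  simple roots linearly independent.\<close>

definition simple_root :: "6 \<Rightarrow> weight" where
  "simple_root i =
     ((\<chi> j. if j = i then 2 else if j = i + 1 \<or> j = i - 1 then -1 else 0), if i = 0 then 1 else 0)"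

definition weight_refl :: "6 \<Rightarrow> weight \<Rightarrow> weight" where
  "weight_refl i x = x - (fst x $ i) *\<^sub>R simple_root i"

definition word_prod :: "6 list \<Rightarrow> weight \<Rightarrow> weight" where
  "word_prod is = foldr (\<lambda>i f. weight_refl i \<circ> f) is id"

text \<open>The action of the affine Weyl group on cores determined by the action of the simple
  reflections: an element is written as any product of simple reflections, which are applied
  successively to the core.\<close>

definition core_act :: "(weight \<Rightarrow> weight) \<Rightarrow> diagram \<Rightarrow> diagram" where
  "core_act w c = (THE d. \<exists>is. word_prod is = w \<and> foldr core_refl is c = d)"

datatype twisted_type = A5_2 | D4_3

definition roots_A5_2 :: "weight list" where
  "roots_A5_2 =
     [2 *\<^sub>R simple_root 0 + simple_root 1 + simple_root 5,
      simple_root 1 + simple_root 5,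
      simple_root 2 + simple_root 4,
      2 *\<^sub>R simple_root 3]"

definition roots_D4_3 :: "weight list" where
  "roots_D4_3 = [roots_A5_2 ! 0, roots_A5_2 ! 2, roots_A5_2 ! 1 + roots_A5_2 ! 3]"

fun roots :: "twisted_type \<Rightarrow> weight list" where
  "roots A5_2 = roots_A5_2"
| "roots D4_3 = roots_D4_3"

fun weyl_gens :: "twisted_type \<Rightarrow> (weight \<Rightarrow> weight) set" where
  "weyl_gens A5_2 = {word_prod [0, 1, 5, 0], word_prod [1, 5], word_prod [2, 4], word_prod [3]}"
| "weyl_gens D4_3 = {word_prod [0, 1, 5, 0], word_prod [2, 4], word_prod [1, 3, 5]}"

definition weyl_group :: "twisted_type \<Rightarrow> (weight \<Rightarrow> weight) set" where
  "weyl_group X = generate (BijGroup UNIV) (weyl_gens X)"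

text \<open>The list of the coefficients \<open>a\<^sub>i\<^sup>X(c)\<close>. Both types have \<open>\<Lambda>\<^sub>0\<close> as their zeroth fundamental
  weight.\<close>

definition atomic_coeffs :: "twisted_type \<Rightarrow> diagram \<Rightarrow> real list" where
  "atomic_coeffs X c = (THE as. length as = length (roots X) \<and>
     (\<exists>w \<in> weyl_group X. c = core_act w {} \<and>
        fund_weight 0 - w (fund_weight 0) = (\<Sum>i < length (roots X). (as ! i) *\<^sub>R (roots X ! i))))"

definition atomic_coeff :: "twisted_type \<Rightarrow> nat \<Rightarrow> diagram \<Rightarrow> real" where
  "atomic_coeff X i c = atomic_coeffs X c ! i"

definition atomic_length :: "twisted_type \<Rightarrow> diagram \<Rightarrow> real" where
  "atomic_length X c = (\<Sum>i < length (roots X). atomic_coeff X i c)"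

end

theory Submission
  imports Defs
begin

text \<open>
Let \<open>a\<^sub>j\<close> be the number of \<open>j\<close>-nodes of a core \<open>c\<close> in the orbit of the empty core, say
\<open>c = w \<cdot> \<emptyset>\<close>. Then \<open>\<Lambda>\<^sub>0 - w \<Lambda>\<^sub>0 = \<Sum>\<^sub>j a\<^sub>j \<alpha>\<^sub>j\<close>, because the reflection \<open>s\<^sub>i\<close> changes \<open>a\<^sub>i\<close> into
\<open>\<delta>\<^bsub>i0\<^esub> + a\<^bsub>i-1\<^esub> + a\<^bsub>i+1\<^esub> - a\<^sub>i\<close> and leaves the other counts alone, on cores and on weights alike.
Membership in \<open>\<C>\<^sub>6\<^sup>g\<close> amounts to \<open>a\<^sub>1 = a\<^sub>5\<close>, \<open>a\<^sub>2 = a\<^sub>4\<close> and \<open>a\<^sub>0 + a\<^sub>3 = 2 a\<^sub>1\<close>. Under these equations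
the weight has coefficients \<open>(a\<^sub>0/2, a\<^sub>1 - a\<^sub>0/2, a\<^sub>2, a\<^sub>3/2)\<close> in the simple roots of type \<open>A\<^sub>5\<^sup>(\<^sup>2\<^sup>)\<close>
and \<open>(a\<^sub>0/2, a\<^sub>2, a\<^sub>1 - a\<^sub>0/2)\<close> in those of type \<open>D\<^sub>4\<^sup>(\<^sup>3\<^sup>)\<close>, so all three quantities equal
\<open>a\<^sub>1 + a\<^sub>2\<close>.

The substance lies in showing that these coefficients are well defined for every \<open>c\<close> in \<open>\<C>\<^sub>6\<^sup>g\<close>.
The behaviour of reflections on cores is read off from the profile of a partition, which counts
the boxes of each content: on profiles, \<open>s\<^sub>i\<close> is the involution
\<open>t(k) \<mapsto> t(k-1) + t(k+1) - t(k)\<close> for \<open>k\<close> congruent to \<open>i\<close> (\<open>core_refl_eq\<close>, \<open>node_count_core_refl\<close>).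
The node counts determine a core (\<open>core_eqI\<close>): some reflection shrinks a nonempty core, and which
reflections do so depends on the counts only. Hence two words with the same product of weight
reflections carry the empty core to the same core (\<open>core_act_word_prod\<close>). Finally, some generator
of the Weyl group of type \<open>D\<^sub>4\<^sup>(\<^sup>3\<^sup>)\<close> shrinks any nonempty core satisfying the three equations and
preserves these equations, so that all such cores lie in the orbit of the empty one
(\<open>symmetric_core_in_orbit\<close>).
\<close>

section \<open>Profiles of partitions\<close>

definition diagonal :: "nat \<times> nat \<Rightarrow> int" where
  "diagonal b = int (snd b) - int (fst b)"

text \<open>The boxes of content \<open>k\<close> in a partition are the first ones on their diagonal, so
\<open>profile c k\<close> is the row index of the first box of that diagonal outside \<open>c\<close>. The summand
\<open>max 0 (- k)\<close> is the row in which the diagonal starts; with it, all contents obey the same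
equations, whatever their sign.\<close>

definition profile :: "diagram \<Rightarrow> int \<Rightarrow> int" where
  "profile c k = max 0 (- k) + int (card {b \<in> c. diagonal b = k})"

text \<open>The drop \<open>t (k - 1) - t k\<close> records the direction of one unit step of the boundary path of the
partition: it is 1 for a vertical step, at the end of a row, and 0 for a horizontal one. The second
condition says that the path eventually follows the two axes.\<close>

definition is_profile :: "(int \<Rightarrow> int) \<Rightarrow> bool" where
  "is_profile t \<longleftrightarrow>
     (\<forall>k. t k \<le> t (k - 1) \<and> t (k - 1) \<le> t k + 1) \<and> finite {k. t k \<noteq> max 0 (- k)}"

definition diagram_of :: "(int \<Rightarrow> int) \<Rightarrow> diagram" where
  "diagram_of t = {(i, j). int i < t (int j - int i)}"

lemma down_closed_eq_lessThan:
  fixes A :: "nat set"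
  assumes "finite A" and "\<And>m n. n \<in> A \<Longrightarrow> m \<le> n \<Longrightarrow> m \<in> A"
  shows "A = {..<card A}"
proof (cases "A = {}")
  case False
  then have "A = {..Max A}"
    using assms by (auto intro: Max_ge Max_in)
  then have "card A = Suc (Max A)"
    by (metis card_atMost)
  then show ?thesis
    using \<open>A = {..Max A}\<close> by (simp add: lessThan_Suc_atMost)
qed simp

lemma partition_down:
  assumes "is_partition c" "(i, j) \<in> c" "i' \<le> i" "j' \<le> j"
  shows "(i', j') \<in> c"
  using assms unfolding is_partition_def by blast

text \<open>Each diagonal of a partition is filled from its start, by closure under going up and left.\<close>

lemma mem_partition_iff:
  assumes "is_partition c"
  shows "(i, j) \<in> c \<longleftrightarrow> int i < profile c (int j - int i)"
proof -
  define k where "k = int j - int i"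
  define corner where "corner n = (n + nat (- k), n + nat k)" for n
  define A where "A = {n. corner n \<in> c}"
  have inj: "inj corner"
    by (auto simp: inj_def corner_def)
  have eq: "{b \<in> c. diagonal b = k} = corner ` A"
  proof (intro Set.set_eqI iffI)
    fix b assume b: "b \<in> {b \<in> c. diagonal b = k}"
    then have "b = corner (fst b - nat (- k))"
      by (cases b) (auto simp: corner_def diagonal_def k_def)
    then show "b \<in> corner ` A"
      using b by (auto simp: A_def)
  qed (auto simp: A_def corner_def diagonal_def k_def)
  have "finite c"
    using assms by (simp add: is_partition_def)
  then have "finite (corner ` A)"
    using eq by (metis finite_Collect_conjI Collect_mem_eq)
  then have "finite A"
    using inj by (meson finite_imageD inj_on_subset subset_UNIV)
  moreover have "m \<in> A" if "n \<in> A" "m \<le> n" for m n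
    using that partition_down[OF assms] by (auto simp: A_def corner_def)
  ultimately have A: "A = {..<card A}"
    by (rule down_closed_eq_lessThan)
  have card: "card {b \<in> c. diagonal b = k} = card A"
    unfolding eq using inj by (intro card_image) (meson inj_on_subset subset_UNIV)
  have "(i, j) = corner (i - nat (- k))"
    by (auto simp: corner_def k_def)
  then have "(i, j) \<in> c \<longleftrightarrow> i - nat (- k) \<in> A"
    by (simp add: A_def)
  also have "\<dots> \<longleftrightarrow> i - nat (- k) < card A"
    by (subst A) simp
  also have "\<dots> \<longleftrightarrow> int i < max 0 (- k) + int (card A)"
    unfolding k_def by linarith
  finally show ?thesis
    using card by (simp add: profile_def k_def)
qed

lemma profile_ge: "max 0 (- k) \<le> profile c k"
  by (simp add: profile_def)

lemma is_profile_profile: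
  assumes "is_partition c"
  shows "is_profile (profile c)"
  unfolding is_profile_def
proof (intro conjI allI)
  fix k
  show "profile c k \<le> profile c (k - 1)"
  proof (rule ccontr)
    assume less: "\<not> ?thesis"
    \<comment> \<open>The last box on diagonal \<open>k\<close>; its left neighbour lies on diagonal \<open>k - 1\<close>.\<close>
    define i where "i = nat (profile c k - 1)"
    have i: "int i = profile c k - 1" "int i + k \<ge> 1"
      using less profile_ge[of "k - 1" c] by (auto simp: i_def)
    define j where "j = nat (int i + k)"
    have j: "int j = int i + k" "j \<ge> 1"
      using i by (auto simp: j_def)
    have "(i, j) \<in> c"
      using i j by (simp add: mem_partition_iff[OF assms])
    then have "(i, j - 1) \<in> c"
      by (rule partition_down[OF assms]) auto
    then show False
      using i j less by (simp add: mem_partition_iff[OF assms] of_nat_diff algebra_simps)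
  qed
next
  fix k
  show "profile c (k - 1) \<le> profile c k + 1"
  proof (rule ccontr)
    assume less: "\<not> ?thesis"
    \<comment> \<open>The last box on diagonal \<open>k - 1\<close>; its upper neighbour lies on diagonal \<open>k\<close>.\<close>
    define i where "i = nat (profile c (k - 1) - 1)"
    have i: "int i = profile c (k - 1) - 1" "i \<ge> 1" "int i + k \<ge> 1"
      using less profile_ge[of "k" c] by (auto simp: i_def)
    define j where "j = nat (int i + k - 1)"
    have j: "int j = int i + k - 1"
      using i by (auto simp: j_def)
    have "(i, j) \<in> c"
      using i j by (simp add: mem_partition_iff[OF assms])
    then have "(i - 1, j) \<in> c"
      by (rule partition_down[OF assms]) auto
    then show False
      using i j less by (simp add: mem_partition_iff[OF assms] of_nat_diff algebra_simps)
  qed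
next
  have "{k. profile c k \<noteq> max 0 (- k)} \<subseteq> diagonal ` c"
  proof
    fix k assume "k \<in> {k. profile c k \<noteq> max 0 (- k)}"
    then have "{b \<in> c. diagonal b = k} \<noteq> {}"
      by (auto simp: profile_def simp del: Collect_empty_eq)
    then show "k \<in> diagonal ` c"
      by auto
  qed
  then show "finite {k. profile c k \<noteq> max 0 (- k)}"
    using assms finite_surj by (auto simp: is_partition_def)
qed

lemma profile_step:
  assumes "is_profile t"
  shows "t k \<le> t (k - 1)" "t (k - 1) \<le> t k + 1" "t (k + 1) \<le> t k" "t k \<le> t (k + 1) + 1"
  using assms[unfolded is_profile_def, THEN conjunct1, rule_format, of k]
    assms[unfolded is_profile_def, THEN conjunct1, rule_format, of "k + 1"]
  by auto

lemma is_profile_mono: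
  assumes "is_profile t" "k \<le> l"
  shows "t l \<le> t k" "t k + k \<le> t l + l"
proof -
  have "t l \<le> t k \<and> t k + k \<le> t l + l"
    using assms(2)
  proof (induction l rule: int_ge_induct)
    case (step l)
    then show ?case
      using profile_step(3,4)[OF assms(1), of l] by auto
  qed simp
  then show "t l \<le> t k" "t k + k \<le> t l + l"
    by auto
qed

text \<open>A profile decreases to its value 0 at large positive \<open>k\<close>, while \<open>t k + k\<close> increases from its value
0 at large negative \<open>k\<close>.\<close>

lemma is_profile_ge:
  assumes "is_profile t"
  shows "max 0 (- k) \<le> t k"
proof -
  have fin: "finite {k. t k \<noteq> max 0 (- k)}"
    using assms by (simp add: is_profile_def)
  have "infinite {max 0 k..}" "infinite {..min 0 k}"
    by (simp_all add: infinite_Ici infinite_Iic)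
  then have "\<not> {max 0 k..} \<subseteq> {k. t k \<noteq> max 0 (- k)}" "\<not> {..min 0 k} \<subseteq> {k. t k \<noteq> max 0 (- k)}"
    using fin finite_subset by blast+
  then obtain l m where l: "max 0 k \<le> l" "t l = max 0 (- l)" and m: "m \<le> min 0 k" "t m = max 0 (- m)"
    unfolding subset_iff atLeast_iff atMost_iff mem_Collect_eq by metis
  have "t l \<le> t k"
    by (rule is_profile_mono(1)[OF assms]) (use l in simp)
  moreover have "t m + m \<le> t k + k"
    by (rule is_profile_mono(2)[OF assms]) (use m in simp)
  ultimately show ?thesis
    using l m by linarith
qed

lemma is_partition_diagram_of:
  assumes t: "is_profile t"
  shows "is_partition (diagram_of t)"
  unfolding is_partition_def
proof (intro conjI allI impI)
  let ?F = "{k. t k \<noteq> max 0 (- k)}"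
  have sub: "diagram_of t \<subseteq> (\<lambda>(k, i). (i, nat (int i + k))) ` (SIGMA k:?F. {..<nat (t k)})"
  proof
    fix b assume b: "b \<in> diagram_of t"
    then obtain i j where [simp]: "b = (i, j)" and ij: "int i < t (int j - int i)"
      by (auto simp: diagram_of_def)
    have "(int j - int i, i) \<in> (SIGMA k:?F. {..<nat (t k)})"
      using ij by auto
    then show "b \<in> (\<lambda>(k, i). (i, nat (int i + k))) ` (SIGMA k:?F. {..<nat (t k)})"
      by (rule rev_image_eqI) simp
  qed
  have "finite ?F"
    using t by (simp add: is_profile_def)
  then have "finite (SIGMA k:?F. {..<nat (t k)})"
    by (intro finite_SigmaI) simp_all
  then show "finite (diagram_of t)"
    using sub by (rule finite_surj)
next
  fix i j i' j' :: nat
  assume ij: "(i, j) \<in> diagram_of t" "i' \<le> i" "j' \<le> j"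
  have "t (int j - int i) \<le> t (int j' - int i)"
    by (rule is_profile_mono(1)[OF t]) (use ij(3) in simp)
  moreover have "t (int j' - int i) + (int j' - int i) \<le> t (int j' - int i') + (int j' - int i')"
    by (rule is_profile_mono(2)[OF t]) (use ij(2) in simp)
  moreover have "int i < t (int j - int i)"
    using ij(1) by (simp add: diagram_of_def)
  ultimately have "int i' < t (int j' - int i')"
    by linarith
  then show "(i', j') \<in> diagram_of t"
    by (simp add: diagram_of_def)
qed

lemma profile_diagram_of:
  assumes t: "is_profile t"
  shows "profile (diagram_of t) = t"
proof
  fix k
  have ge: "max 0 (- k) \<le> t k"
    by (rule is_profile_ge[OF t])
  have "{b \<in> diagram_of t. diagonal b = k} = (\<lambda>i. (i, nat (int i + k))) ` {nat (max 0 (- k))..<nat (t k)}"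
  proof (intro Set.set_eqI iffI)
    fix b assume "b \<in> {b \<in> diagram_of t. diagonal b = k}"
    then obtain i j where b: "b = (i, j)" "int j = int i + k" "int i < t k"
      by (cases b) (auto simp: diagonal_def diagram_of_def)
    then have "b = (i, nat (int i + k))" "i \<in> {nat (max 0 (- k))..<nat (t k)}"
      by auto
    then show "b \<in> (\<lambda>i. (i, nat (int i + k))) ` {nat (max 0 (- k))..<nat (t k)}"
      by blast
  qed (auto simp: diagonal_def diagram_of_def)
  then have "card {b \<in> diagram_of t. diagonal b = k} = nat (t k) - nat (max 0 (- k))"
    by (simp add: card_image inj_on_def)
  then show "profile (diagram_of t) k = t k"
    using ge unfolding profile_def by linarith
qed

lemma diagram_of_profile:
  assumes "is_partition c"
  shows "diagram_of (profile c) = c"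
  using mem_partition_iff[OF assms] by (auto simp: diagram_of_def)

section \<open>Cores\<close>

text \<open>On an abacus with six runners, whose beads are the vertical steps of the boundary path, this says
that every bead has a bead in the position before it on its runner.\<close>

definition flush :: "(int \<Rightarrow> int) \<Rightarrow> bool" where
  "flush t \<longleftrightarrow> (\<forall>x. t (x - 1) - t x \<le> t (x - 7) - t (x - 6))"

text \<open>A vertical step at \<open>x\<close> and a horizontal step at \<open>x - 6\<close> are the ends of a row \<open>r\<close> and of a column
\<open>j\<close>; the length of the hook at their crossing is the difference of the two positions, namely 6.\<close>

lemma cores6_flush:
  assumes "c \<in> cores6"
  shows "flush (profile c)"
  unfolding flush_def
proof (rule allI, rule ccontr)
  fix x
  assume not: "\<not> profile c (x - 1) - profile c x \<le> profile c (x - 7) - profile c (x - 6)"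
  have c: "is_partition c" and hooks: "\<And>i j. (i, j) \<in> c \<Longrightarrow> card (hook c i j) \<noteq> 6"
    using assms by (auto simp: cores6_def)
  note t = is_profile_profile[OF c]
  define r q where "r = nat (profile c x)" and "q = nat (profile c (x - 6))"
  have r: "int r = profile c x" and q: "int q = profile c (x - 6)"
    using is_profile_ge[OF t, of x] is_profile_ge[OF t, of "x - 6"] by (auto simp: r_def q_def)
  have r1: "profile c (x - 1) = int r + 1" and q1: "profile c (x - 7) = int q"
    using not profile_step(1,2)[OF t, of x] profile_step(1,2)[OF t, of "x - 6"] r q by auto
  have rq: "r < q"
    using is_profile_mono(1)[OF t, of "x - 6" "x - 1"] r1 q by simp
  have qr: "int q \<le> int r + 6"
    using is_profile_mono(2)[OF t, of "x - 6" x] r q by simp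
  define j e where "j = nat (int q + x - 7)" and "e = nat (int r + x)"
  have j: "int j = int q + x - 7"
    using is_profile_ge[OF t, of "x - 7"] q1 by (auto simp: j_def)
  have e: "int e = int r + x"
    using is_profile_ge[OF t, of "x"] r by (auto simp: e_def)
  have je: "j < e"
    using j e qr by linarith
  have row: "(r, j') \<in> c \<longleftrightarrow> j' < e" for j'
  proof
    assume "j' < e"
    have "(r, e - 1) \<in> c"
      using e je r1 by (simp add: mem_partition_iff[OF c] of_nat_diff)
    then show "(r, j') \<in> c"
      by (rule partition_down[OF c]) (use \<open>j' < e\<close> in auto)
  next
    assume "(r, j') \<in> c"
    then have "e \<le> j' \<Longrightarrow> (r, e) \<in> c"
      using partition_down[OF c] by blast
    then show "j' < e"
      using e r by (auto simp: mem_partition_iff[OF c] not_le[symmetric])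
  qed
  have col: "(i', j) \<in> c \<longleftrightarrow> i' < q" for i'
  proof
    assume "i' < q"
    have "(q - 1, j) \<in> c"
      using j q rq by (simp add: mem_partition_iff[OF c] of_nat_diff)
    then show "(i', j) \<in> c"
      by (rule partition_down[OF c]) (use \<open>i' < q\<close> in auto)
  next
    assume "(i', j) \<in> c"
    then have "q \<le> i' \<Longrightarrow> (q, j) \<in> c"
      using partition_down[OF c] by blast
    then show "i' < q"
      using j q1 by (auto simp: mem_partition_iff[OF c] not_le[symmetric])
  qed
  have "hook c r j = Pair r ` {j..<e} \<union> (\<lambda>i. (i, j)) ` {r..<q}"
    using row col by (auto simp: hook_def)
  also have "\<dots> = Pair r ` {j..<e} \<union> (\<lambda>i. (i, j)) ` {r<..<q}"
    using rq je by (auto simp: image_iff nat_less_le)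
  also have "card \<dots> = (e - j) + (q - r - 1)"
    by (subst card_Un_disjoint) (auto simp: card_image inj_on_def)
  also have "\<dots> = 6"
    using e j rq je by linarith
  finally show False
    using hooks row je by blast
qed

text \<open>The abacus form of the core condition, which is evidently preserved by reflections.\<close>

definition core :: "diagram \<Rightarrow> bool" where
  "core c \<longleftrightarrow> is_partition c \<and> flush (profile c)"

lemma core_cores6: "c \<in> cores6 \<Longrightarrow> core c"
  using cores6_flush by (auto simp: core_def cores6_def)

lemma core_empty: "core {}"
proof -
  have "profile {} = (\<lambda>k. max 0 (- k))"
    by (auto simp: profile_def)
  then show ?thesis
    by (auto simp: core_def is_partition_def flush_def)
qed

text \<open>Exchanging the boundary steps at \<open>k\<close> and \<open>k + 1\<close>, for every \<open>k\<close> of residue \<open>i\<close>.\<close>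

definition refl_profile :: "6 \<Rightarrow> (int \<Rightarrow> int) \<Rightarrow> int \<Rightarrow> int" where
  "refl_profile i t k = (if of_int k = i then t (k - 1) + t (k + 1) - t k else t k)"

lemma is_profile_refl_profile:
  assumes t: "is_profile t"
  shows "is_profile (refl_profile i t)"
  unfolding is_profile_def
proof (intro conjI allI)
  fix k
  show "refl_profile i t k \<le> refl_profile i t (k - 1)"
    "refl_profile i t (k - 1) \<le> refl_profile i t k + 1"
    using profile_step[OF t, of k] profile_step[OF t, of "k - 1"]
    by (auto simp: refl_profile_def)
next
  let ?F = "{k. t k \<noteq> max 0 (- k)}"
  have fin: "finite ?F"
    using t by (simp add: is_profile_def)
  have "{k. refl_profile i t k \<noteq> max 0 (- k)} \<subseteq> {0} \<union> ?F \<union> (\<lambda>k. k + 1) ` ?F \<union> (\<lambda>k. k - 1) ` ?F"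
  proof
    fix k assume k: "k \<in> {k. refl_profile i t k \<noteq> max 0 (- k)}"
    show "k \<in> {0} \<union> ?F \<union> (\<lambda>k. k + 1) ` ?F \<union> (\<lambda>k. k - 1) ` ?F"
    proof (rule ccontr)
      assume n: "\<not> ?thesis"
      have "k - 1 \<notin> ?F" "k + 1 \<notin> ?F" 
        using n by (auto simp: image_iff dest: spec[of _ "k - 1"] spec[of _ "k + 1"])
      then show False
        using n k by (auto simp: refl_profile_def split: if_splits)
    qed
  qed
  then show "finite {k. refl_profile i t k \<noteq> max 0 (- k)}"
    using fin finite_subset by (metis (no_types, lifting) finite.emptyI finite.insertI finite_UnI finite_imageI)
qed

lemma refl_profile_idem: "refl_profile i (refl_profile i t) = t"
  by (rule ext) (auto simp: refl_profile_def)

lemma flush_refl_profile: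
  assumes "flush t"
  shows "flush (refl_profile i t)"
  unfolding flush_def
proof
  fix x
  have six: "(6 :: 6) = 0" "(7 :: 6) = 1"
    by simp_all
  show "refl_profile i t (x - 1) - refl_profile i t x
      \<le> refl_profile i t (x - 7) - refl_profile i t (x - 6)"
    using assms[unfolded flush_def, rule_format, of x] assms[unfolded flush_def, rule_format, of "x - 1"]
      assms[unfolded flush_def, rule_format, of "x + 1"]
    by (auto simp: refl_profile_def six)
qed


lemma residue_diagonal: "residue b = of_int (diagonal b)"
  by (simp add: residue_def diagonal_def)

lemma is_partition_remove_iff:
  assumes c: "is_partition c" and b: "(r, j) \<in> c"
  shows "is_partition (c - {(r, j)}) \<longleftrightarrow> (r, j + 1) \<notin> c \<and> (r + 1, j) \<notin> c"
proof
  assume p: "is_partition (c - {(r, j)})"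
  show "(r, j + 1) \<notin> c \<and> (r + 1, j) \<notin> c"
    using partition_down[OF p, of r "j + 1" r j] partition_down[OF p, of "r + 1" j r j] by auto
next
  assume out: "(r, j + 1) \<notin> c \<and> (r + 1, j) \<notin> c"
  show "is_partition (c - {(r, j)})"
    unfolding is_partition_def
  proof (intro conjI allI impI)
    show "finite (c - {(r, j)})"
      using c by (simp add: is_partition_def)
  next
    fix x y x' y'
    assume xy: "(x, y) \<in> c - {(r, j)}" "x' \<le> x" "y' \<le> y"
    then have "(x', y') \<in> c"
      using partition_down[OF c] by blast
    moreover have "(x', y') \<noteq> (r, j)"
    proof
      assume "(x', y') = (r, j)"
      then have "r + 1 \<le> x \<and> j \<le> y \<or> r \<le> x \<and> j + 1 \<le> y"
        using xy by auto
      then show False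
        using partition_down[OF c, of x y] out xy(1) by blast
    qed
    ultimately show "(x', y') \<in> c - {(r, j)}"
      by blast
  qed
qed

lemma is_partition_insert_iff:
  assumes c: "is_partition c" and b: "(r, j) \<notin> c"
  shows "is_partition (insert (r, j) c) \<longleftrightarrow>
    (r = 0 \<or> (r - 1, j) \<in> c) \<and> (j = 0 \<or> (r, j - 1) \<in> c)"
proof
  assume p: "is_partition (insert (r, j) c)"
  show "(r = 0 \<or> (r - 1, j) \<in> c) \<and> (j = 0 \<or> (r, j - 1) \<in> c)"
    using partition_down[OF p, of r j "r - 1" j] partition_down[OF p, of r j r "j - 1"] by auto
next
  assume inner: "(r = 0 \<or> (r - 1, j) \<in> c) \<and> (j = 0 \<or> (r, j - 1) \<in> c)"
  show "is_partition (insert (r, j) c)"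
    unfolding is_partition_def
  proof (intro conjI allI impI)
    show "finite (insert (r, j) c)"
      using c by (simp add: is_partition_def)
  next
    fix x y x' y'
    assume xy: "(x, y) \<in> insert (r, j) c" "x' \<le> x" "y' \<le> y"
    show "(x', y') \<in> insert (r, j) c"
    proof (cases "(x, y) = (r, j) \<and> (x', y') \<noteq> (r, j)")
      case True
      then have "r \<noteq> 0 \<and> x' \<le> r - 1 \<and> y' \<le> j \<or> j \<noteq> 0 \<and> x' \<le> r \<and> y' \<le> j - 1"
        using xy by auto
      then show ?thesis
        using partition_down[OF c] inner by blast
    next
      case False
      then show ?thesis
        using xy partition_down[OF c] by blast
    qed
  qed
qed

text \<open>A box is removable when the boundary makes a horizontal step at its content \<open>k\<close> and then a vertical
one, and addable when these steps occur in the other order.\<close>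

lemma mem_removable_iff:
  assumes c: "is_partition c" and k: "k = int j - int r"
  shows "(r, j) \<in> removable i c \<longleftrightarrow> of_int k = i \<and>
    int r < profile c k \<and> profile c (k + 1) \<le> int r \<and> profile c (k - 1) \<le> int r + 1"
proof (cases "(r, j) \<in> c")
  case True
  have *: "int (j + 1) - int r = k + 1" "int j - int (r + 1) = k - 1"
    using k by auto
  show ?thesis
    using True unfolding removable_def mem_Collect_eq residue_diagonal is_partition_remove_iff[OF c True]
    by (simp only: mem_partition_iff[OF c] * k[symmetric] diagonal_def fst_conv snd_conv) auto
next
  case False
  then show ?thesis
    using k by (auto simp: removable_def mem_partition_iff[OF c])
qed

lemma mem_addable_iff:
  assumes c: "is_partition c" and k: "k = int j - int r"
  shows "(r, j) \<in> addable i c \<longleftrightarrow> of_int k = i \<and>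
    profile c k \<le> int r \<and> int r \<le> profile c (k + 1) \<and> int r < profile c (k - 1)"
proof (cases "(r, j) \<in> c")
  case False
  have "r = 0 \<or> (r - 1, j) \<in> c \<longleftrightarrow> int r \<le> profile c (k + 1)"
  proof (cases "r = 0")
    case False
    then have eq: "int j - int (r - 1) = k + 1" "int (r - 1) = int r - 1"
      using k by auto
    show ?thesis
      unfolding mem_partition_iff[OF c] eq(1) unfolding eq(2) using False by linarith
  qed (use profile_ge[of "k + 1" c] in auto)
  moreover have "j = 0 \<or> (r, j - 1) \<in> c \<longleftrightarrow> int r < profile c (k - 1)"
  proof (cases "j = 0")
    case False
    then have eq: "int (j - 1) - int r = k - 1"
      using k by auto
    show ?thesis
      unfolding mem_partition_iff[OF c] eq using False by simp
  qed (use k profile_ge[of "k - 1" c] in auto)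
  ultimately show ?thesis
    using False k unfolding addable_def mem_Collect_eq residue_diagonal is_partition_insert_iff[OF c False]
    by (auto simp: mem_partition_iff[OF c] diagonal_def)
next
  case True
  then show ?thesis
    using k by (auto simp: addable_def mem_partition_iff[OF c])
qed

lemma flush_antimono:
  assumes "flush t" and kl: "of_int k = (of_int l :: 6)" "k \<le> l"
  shows "t (l - 1) - t l \<le> t (k - 1) - t k"
proof -
  have "of_int (l - k) = (0 :: 6)"
    using kl by simp
  then have "int CHAR(6) dvd l - k"
    by (simp only: of_int_eq_0_iff_char_dvd)
  then obtain n where "l - k = 6 * n"
    by auto
  then have l: "l = k + 6 * int (nat n)"
    using kl by simp
  have "t (k + 6 * int m - 1) - t (k + 6 * int m) \<le> t (k - 1) - t k" for m
  proof (induction m)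
    case (Suc m)
    have "k + 6 * int (Suc m) - 7 = k + 6 * int m - 1" "k + 6 * int (Suc m) - 6 = k + 6 * int m"
      by simp_all
    then show ?case
      using assms(1)[unfolded flush_def, rule_format, of "k + 6 * int (Suc m)"] Suc.IH by simp
  qed simp
  then show ?thesis
    using l by metis
qed

text \<open>A core has no addable and removable nodes of the same residue: among \<open>k\<close> and \<open>l\<close>, the vertical step
next to the larger one forces a vertical step at the corresponding place next to the smaller one.\<close>

lemma flush_dichotomy:
  assumes t: "is_profile t" "flush t" and kl: "of_int k = (of_int l :: 6)"
    and less: "t (k - 1) - t k < t k - t (k + 1)"
  shows "t (l - 1) - t l \<le> t l - t (l + 1)"
proof (cases "k \<le> l")
  case True
  then have "t (l - 1) - t l \<le> t (k - 1) - t k"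
    using flush_antimono[OF t(2) kl] by simp
  then show ?thesis
    using less profile_step[OF t(1), of l] profile_step[OF t(1), of k] by linarith
next
  case False
  then have "t k - t (k + 1) \<le> t l - t (l + 1)"
    using flush_antimono[OF t(2), of "l + 1" "k + 1"] kl by simp
  then show ?thesis
    using less profile_step[OF t(1), of l] profile_step[OF t(1), of k] by linarith
qed

text \<open>By \<open>flush_dichotomy\<close>, every exchange of steps of a core at residue \<open>i\<close> that has an effect goes in
the same direction: all of them remove a box, or all of them add one.\<close>

lemma core_refl_eq:
  assumes "core c"
  shows "core_refl i c = diagram_of (refl_profile i (profile c))"
proof -
  let ?t = "profile c"
  have c: "is_partition c" and fl: "flush ?t"
    using assms by (auto simp: core_def)
  note t = is_profile_profile[OF c]
  show ?thesis
  proof (cases "removable i c = {}")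
    case False
    then obtain r j where rj: "(r, j) \<in> removable i c"
      by auto
    define k where "k = int j - int r"
    have k: "of_int k = i" "?t (k - 1) - ?t k < ?t k - ?t (k + 1)"
      using rj profile_step[OF t, of k] by (auto simp: mem_removable_iff[OF c k_def])
    have "(r, j) \<in> c - removable i c \<longleftrightarrow> (r, j) \<in> diagram_of (refl_profile i ?t)" for r j
    proof -
      define l where "l = int j - int r"
      have "?t (l - 1) - ?t l \<le> ?t l - ?t (l + 1)" if "of_int l = i"
        using flush_dichotomy[OF t fl _ k(2), of l] that k(1) by simp
      then have "int r < ?t l \<and> \<not> (of_int l = i \<and> int r < ?t l \<and> ?t (l + 1) \<le> int r
          \<and> ?t (l - 1) \<le> int r + 1) \<longleftrightarrow> int r < refl_profile i ?t l"
        using profile_step[OF t, of l] by (cases "of_int l = i") (auto simp: refl_profile_def)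
      then show ?thesis
        by (simp add: mem_removable_iff[OF c l_def] diagram_of_def mem_partition_iff[OF c]
            del: of_int_diff flip: l_def)
    qed
    then show ?thesis
      using False by (auto simp: core_refl_def)
  next
    case True
    have ge: "?t l - ?t (l + 1) \<le> ?t (l - 1) - ?t l" if "of_int l = i" for l
    proof (rule ccontr)
      assume not: "\<not> ?thesis"
      define r j where "r = nat (?t l - 1)" and "j = nat (?t l - 1 + l)"
      have r: "int r = ?t l - 1" and j: "int j = ?t l - 1 + l"
        using not profile_step[OF t, of l] profile_ge[of "l + 1" c] profile_ge[of "l - 1" c]
        by (auto simp: r_def j_def)
      have "l = int j - int r"
        using r j by simp
      then have "(r, j) \<in> removable i c"
        using not profile_step[OF t, of l] that r by (simp add: mem_removable_iff[OF c])
      then show False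
        using True by simp
    qed
    have "(r, j) \<in> c \<union> addable i c \<longleftrightarrow> (r, j) \<in> diagram_of (refl_profile i ?t)" for r j
    proof -
      define l where "l = int j - int r"
      have "int r < ?t l \<or> of_int l = i \<and> ?t l \<le> int r \<and> int r \<le> ?t (l + 1)
          \<and> int r < ?t (l - 1) \<longleftrightarrow> int r < refl_profile i ?t l"
        using profile_step[OF t, of l] ge[of l]
        by (cases "of_int l = i") (auto simp: refl_profile_def)
      then show ?thesis
        by (simp add: mem_addable_iff[OF c l_def] diagram_of_def mem_partition_iff[OF c]
            del: of_int_diff flip: l_def)
    qed
    then show ?thesis
      using True by (auto simp: core_refl_def)
  qed
qed

lemma profile_core_refl:
  assumes "core c"
  shows "profile (core_refl i c) = refl_profile i (profile c)"
  using assms core_refl_eq is_profile_profile is_profile_refl_profile profile_diagram_of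
  by (simp add: core_def)

lemma core_core_refl:
  assumes "core c"
  shows "core (core_refl i c)"
  using assms is_profile_profile is_profile_refl_profile is_partition_diagram_of flush_refl_profile
    profile_core_refl[OF assms] core_refl_eq[OF assms]
  by (simp add: core_def)

lemma core_refl_idem:
  assumes "core c"
  shows "core_refl i (core_refl i c) = c"
  using assms core_core_refl[OF assms]
  by (simp add: core_refl_eq[of "core_refl i c"] profile_core_refl refl_profile_idem
      diagram_of_profile core_def)

section \<open>Counting nodes\<close>

lemma node_count_eq_sum:
  assumes c: "is_partition c" and K: "finite K" "\<And>k. k \<in> K \<Longrightarrow> of_int k = i"
    and supp: "\<And>k. of_int k = i \<Longrightarrow> profile c k \<noteq> max 0 (- k) \<Longrightarrow> k \<in> K"
  shows "int (node_count i c) = (\<Sum>k\<in>K. profile c k - max 0 (- k))"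
proof -
  have fin: "finite c"
    using c by (simp add: is_partition_def)
  have "diagonal b \<in> K" if "b \<in> c" "of_int (diagonal b) = i" for b
  proof (rule supp)
    have "{b' \<in> c. diagonal b' = diagonal b} \<noteq> {}"
      using that by blast
    then have "card {b' \<in> c. diagonal b' = diagonal b} \<noteq> 0"
      using fin by (subst card_0_eq) auto
    then show "profile c (diagonal b) \<noteq> max 0 (- diagonal b)"
      by (simp add: profile_def)
  qed (use that in simp)
  then have "{b \<in> c. residue b = i} = (\<Union>k\<in>K. {b \<in> c. diagonal b = k})"
    using K(2) by (auto simp: residue_diagonal)
  then have "node_count i c = (\<Sum>k\<in>K. card {b \<in> c. diagonal b = k})"
    unfolding node_count_def using K(1) fin by (subst card_UN_disjoint[symmetric]) auto
  then show ?thesis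
    by (simp add: profile_def)
qed

text \<open>Sum the formula for the reflected profile over all \<open>k\<close> of residue \<open>i\<close>. The term \<open>\<delta>\<^bsub>i0\<^esub>\<close> is the
second difference of \<open>max 0 (- k)\<close>, which vanishes except at \<open>k = 0\<close>.\<close>

lemma node_count_core_refl:
  assumes "core c"
  shows "int (node_count j (core_refl i c)) =
    (if j = i
     then (if i = 0 then 1 else 0) + int (node_count (i - 1) c) + int (node_count (i + 1) c)
       - int (node_count i c)
     else int (node_count j c))"
proof -
  let ?t = "profile c" and ?t' = "profile (core_refl i c)"
  let ?e = "\<lambda>k. max 0 (- k) :: int"
  have c: "is_partition c" and c': "is_partition (core_refl i c)"
    using assms core_core_refl[OF assms] by (auto simp: core_def)
  have t': "?t' = refl_profile i ?t"
    by (rule profile_core_refl[OF assms])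
  define F where "F = {k. ?t k \<noteq> ?e k}"
  have F: "finite F"
    using is_profile_profile[OF c] by (simp add: F_def is_profile_def)
  show ?thesis
  proof (cases "j = i")
    case False
    let ?K = "{k \<in> F. of_int k = j}"
    have "int (node_count j (core_refl i c)) = (\<Sum>k\<in>?K. ?t' k - ?e k)"
      using F False by (intro node_count_eq_sum[OF c']) (auto simp: t' refl_profile_def F_def)
    also have "\<dots> = (\<Sum>k\<in>?K. ?t k - ?e k)"
      using False by (intro sum.cong) (auto simp: t' refl_profile_def)
    also have "\<dots> = int (node_count j c)"
      using F by (intro node_count_eq_sum[OF c, symmetric]) (auto simp: F_def)
    finally show ?thesis
      using False by simp
  next
    case True
    \<comment> \<open>A finite set of contents large enough to cover the supports after a shift by one, and
      containing 0 if \<open>i = 0\<close>.\<close>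
    define K where "K = {k \<in> insert 0 (F \<union> (\<lambda>k. k + 1) ` F \<union> (\<lambda>k. k - 1) ` F). of_int k = i}"
    have K: "finite K" "\<And>k. k \<in> K \<Longrightarrow> of_int k = i"
      using F by (auto simp: K_def)
    have inK: "k \<in> K" if "of_int k = i" "k \<in> F \<or> k - 1 \<in> F \<or> k + 1 \<in> F \<or> k = 0" for k
      using that by (force simp: K_def)
    have up: "int (node_count (i + 1) c) = (\<Sum>k\<in>K. ?t (k + 1) - ?e (k + 1))"
    proof -
      have "int (node_count (i + 1) c) = (\<Sum>k\<in>(\<lambda>k. k + 1) ` K. ?t k - ?e k)"
      proof (rule node_count_eq_sum[OF c])
        fix k assume "of_int k = i + 1" "?t k \<noteq> ?e k"
        then have "k - 1 \<in> K"
          by (intro inK) (auto simp: F_def)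
        then show "k \<in> (\<lambda>k. k + 1) ` K"
          by (rule rev_image_eqI) simp
      qed (use K in auto)
      then show ?thesis
        by (simp add: sum.reindex inj_on_def)
    qed
    have down: "int (node_count (i - 1) c) = (\<Sum>k\<in>K. ?t (k - 1) - ?e (k - 1))"
    proof -
      have "int (node_count (i - 1) c) = (\<Sum>k\<in>(\<lambda>k. k - 1) ` K. ?t k - ?e k)"
      proof (rule node_count_eq_sum[OF c])
        fix k assume "of_int k = i - 1" "?t k \<noteq> ?e k"
        then have "k + 1 \<in> K"
          by (intro inK) (auto simp: F_def)
        then show "k \<in> (\<lambda>k. k - 1) ` K"
          by (rule rev_image_eqI) simp
      qed (use K in auto)
      then show ?thesis
        by (simp add: sum.reindex inj_on_def)
    qed
    have mid: "int (node_count i c) = (\<Sum>k\<in>K. ?t k - ?e k)"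
      using K inK by (intro node_count_eq_sum[OF c]) (auto simp: F_def)
    have "int (node_count i (core_refl i c)) = (\<Sum>k\<in>K. ?t' k - ?e k)"
    proof (rule node_count_eq_sum[OF c' K])
      fix k assume k: "of_int k = i" "?t' k \<noteq> ?e k"
      show "k \<in> K"
        using k by (intro inK) (auto simp: F_def t' refl_profile_def)
    qed
    also have "\<dots> = (\<Sum>k\<in>K. (?t (k - 1) - ?e (k - 1)) + (?t (k + 1) - ?e (k + 1)) - (?t k - ?e k)
        + (if k = 0 then 1 else 0))"
      using K(2) by (intro sum.cong) (auto simp: t' refl_profile_def)
    also have "\<dots> = (\<Sum>k\<in>K. ?t (k - 1) - ?e (k - 1)) + (\<Sum>k\<in>K. ?t (k + 1) - ?e (k + 1))
        - (\<Sum>k\<in>K. ?t k - ?e k) + (\<Sum>k\<in>K. if k = 0 then 1 else 0)"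
      unfolding sum.distrib sum_subtractf by simp
    also have "(\<Sum>k\<in>K. if k = 0 then 1 else 0) = (if i = 0 then 1 else 0 :: int)"
      using K(1) by (auto simp: K_def)
    finally show ?thesis
      using True up down mid by simp
  qed
qed

text \<open>A box as far as possible from the corner, in the sum of its coordinates, is removable.\<close>

lemma removable_nonempty:
  assumes c: "is_partition c" "c \<noteq> {}"
  obtains i where "removable i c \<noteq> {}"
proof -
  have fin: "finite c"
    using c by (simp add: is_partition_def)
  obtain r j where rj: "(r, j) \<in> c" and mx: "\<And>r' j'. (r', j') \<in> c \<Longrightarrow> r' + j' \<le> r + j"
  proof -
    have "Max ((\<lambda>(r, j). r + j) ` c) \<in> (\<lambda>(r, j). r + j) ` c"
      using fin c(2) by (intro Max_in) auto
    then obtain r j where "(r, j) \<in> c" "r + j = Max ((\<lambda>(r, j). r + j) ` c)"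
      by force
    moreover have "r' + j' \<le> Max ((\<lambda>(r, j). r + j) ` c)" if "(r', j') \<in> c" for r' j'
      using fin that by (intro Max_ge) force+
    ultimately show thesis
      using that by metis
  qed
  have "(r, j) \<in> removable (residue (r, j)) c"
    using rj mx[of "r + 1" j] mx[of r "j + 1"]
    by (auto simp: removable_def is_partition_remove_iff[OF c(1) rj])
  then show thesis
    using that by blast
qed

lemma node_count_decreases:
  assumes "core c" "c \<noteq> {}"
  obtains i where "node_count i (core_refl i c) < node_count i c"
proof -
  have c: "is_partition c"
    using assms by (simp add: core_def)
  then obtain i where i: "removable i c \<noteq> {}"
    using removable_nonempty assms(2) by blast
  have "{b \<in> c - removable i c. residue b = i} \<subset> {b \<in> c. residue b = i}"
    using i by (auto simp: removable_def)
  moreover have "finite {b \<in> c. residue b = i}"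
    using c by (simp add: is_partition_def)
  ultimately have "node_count i (core_refl i c) < node_count i c"
    using i psubset_card_mono by (simp add: core_refl_def node_count_def)
  then show thesis
    using that by blast
qed

lemma exhaust_6:
  fixes x :: 6
  shows "x = 0 \<or> x = 1 \<or> x = 2 \<or> x = 3 \<or> x = 4 \<or> x = 5"
proof (induct x)
  case (of_int z)
  then have "z = 0 \<or> z = 1 \<or> z = 2 \<or> z = 3 \<or> z = 4 \<or> z = 5"
    by fastforce
  then show ?case
    by auto
qed

lemma UNIV_6: "UNIV = {0, 1, 2, 3, 4, 5 :: 6}"
  using exhaust_6 by auto

lemma wrap_6: "(- 1 :: 6) = 5" "(6 :: 6) = 0"
  by (rule minus_unique) simp_all

lemma sum_6: "sum f (UNIV :: 6 set) = f 0 + f 1 + f 2 + f 3 + f 4 + f 5"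
  for f :: "6 \<Rightarrow> 'a :: comm_monoid_add"
  unfolding UNIV_6 by (simp add: ac_simps)

lemma card_eq_sum_node_count:
  assumes "finite c"
  shows "card c = (\<Sum>i\<in>UNIV. node_count i c)"
proof -
  have "c = (\<Union>i\<in>UNIV. {b \<in> c. residue b = i})"
    by auto
  then have "card c = card (\<Union>i\<in>UNIV. {b \<in> c. residue b = i})"
    by simp
  also have "\<dots> = (\<Sum>i\<in>UNIV. card {b \<in> c. residue b = i})"
    using assms by (intro card_UN_disjoint) auto
  finally show ?thesis
    by (simp add: node_count_def)
qed


text \<open>Induction on the size. A reflection that shrinks \<open>c\<close> turns the counts of \<open>c\<close> and \<open>d\<close> into the same
smaller ones, and it is an involution on cores.\<close>

lemma core_eqI:
  assumes "core c" "core d" and "\<And>i. node_count i c = node_count i d"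
  shows "c = d"
  using assms
proof (induction "card c" arbitrary: c d rule: less_induct)
  case less
  have fin: "finite c" "finite d"
    using less.prems by (auto simp: core_def is_partition_def)
  have card: "card c = card d"
    using less.prems fin by (simp add: card_eq_sum_node_count)
  show ?case
  proof (cases "c = {}")
    case True
    then show ?thesis
      using card fin by simp
  next
    case False
    then obtain i where i: "node_count i (core_refl i c) < node_count i c"
      using node_count_decreases less.prems by blast
    have other: "node_count j (core_refl i c) = node_count j c" if "j \<noteq> i" for j
      using node_count_core_refl[OF less.prems(1), of j i] that by simp
    then have le: "node_count j (core_refl i c) \<le> node_count j c" for j
      using i by (cases "j = i") simp_all
    have fin': "finite (core_refl i c)"
      using core_core_refl[OF less.prems(1)] by (auto simp: core_def is_partition_def)
    have "card (core_refl i c) < card c"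
      unfolding card_eq_sum_node_count[OF fin(1)] card_eq_sum_node_count[OF fin']
      using i le by (intro sum_strict_mono_ex1) auto
    moreover have "node_count j (core_refl i c) = node_count j (core_refl i d)" for j
      using node_count_core_refl[OF less.prems(1), of j i]
        node_count_core_refl[OF less.prems(2), of j i] less.prems(3)
      by (simp split: if_splits)
    ultimately have "core_refl i c = core_refl i d"
      using less.hyps core_core_refl less.prems by blast
    then show ?thesis
      using core_refl_idem less.prems by metis
  qed
qed

section \<open>Weights\<close>

definition weight_of :: "diagram \<Rightarrow> weight" where
  "weight_of c = fund_weight 0 - (\<Sum>j\<in>UNIV. real (node_count j c) *\<^sub>R simple_root j)"

lemma forall_6: "(\<forall>i :: 6. P i) \<longleftrightarrow> P 0 \<and> P 1 \<and> P 2 \<and> P 3 \<and> P 4 \<and> P 5"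
  by (metis exhaust_6)

text \<open>The columns of the affine Cartan matrix satisfy one linear relation, whose coefficients are all
equal to 1; the null root component of the zeroth root excludes it.\<close>

lemma simple_roots_independent:
  fixes x y :: "6 \<Rightarrow> real"
  assumes eq: "(\<Sum>j\<in>UNIV. x j *\<^sub>R simple_root j) = (\<Sum>j\<in>UNIV. y j *\<^sub>R simple_root j)"
  shows "x = y"
proof -
  have 0: "x 0 = y 0"
    using arg_cong[OF eq, of snd] by (simp add: sum_6 simple_root_def)
  have "fst (\<Sum>j\<in>UNIV. x j *\<^sub>R simple_root j) $ i = fst (\<Sum>j\<in>UNIV. y j *\<^sub>R simple_root j) $ i" for i
    using eq by simp
  from this[of 1] this[of 2] this[of 3] this[of 4] this[of 5]
  have "x 1 = y 1 \<and> x 2 = y 2 \<and> x 3 = y 3 \<and> x 4 = y 4 \<and> x 5 = y 5"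
    using 0 by (simp add: sum_6 simple_root_def)
  then have "\<forall>i. x i = y i"
    using 0 unfolding forall_6 by blast
  then show ?thesis
    by blast
qed

lemma weight_of_coord:
  "fst (weight_of c) $ i = (if i = 0 then 1 else 0) + real (node_count (i - 1) c)
     + real (node_count (i + 1) c) - 2 * real (node_count i c)"
proof -
  have "\<forall>i. fst (weight_of c) $ i = (if i = 0 then 1 else 0) + real (node_count (i - 1) c)
     + real (node_count (i + 1) c) - 2 * real (node_count i c)"
    unfolding forall_6
    by (simp add: weight_of_def fund_weight_def simple_root_def sum_6 axis_def wrap_6)
  then show ?thesis
    by blast
qed

text \<open>The reflection adds \<open>\<langle>x, \<alpha>\<^sub>i\<^sup>\<or>\<rangle>\<close> nodes of residue \<open>i\<close>, where \<open>x\<close> is the weight of \<open>c\<close>: this is the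
formula of \<open>node_count_core_refl\<close> read through \<open>weight_of_coord\<close>.\<close>

lemma weight_of_core_refl:
  assumes "core c"
  shows "weight_of (core_refl i c) = weight_refl i (weight_of c)"
proof -
  have "real (node_count j (core_refl i c)) =
      real (node_count j c) + (if j = i then fst (weight_of c) $ i else 0)" for j
    using arg_cong[OF node_count_core_refl[OF assms, of j i], of real_of_int]
    by (auto simp: weight_of_coord)
  then have "(\<Sum>j\<in>UNIV. real (node_count j (core_refl i c)) *\<^sub>R simple_root j) =
      (\<Sum>j\<in>UNIV. real (node_count j c) *\<^sub>R simple_root j
        + (if j = i then (fst (weight_of c) $ i) *\<^sub>R simple_root j else 0))"
    by (intro sum.cong) (auto simp: scaleR_add_left)
  also have "\<dots> = (\<Sum>j\<in>UNIV. real (node_count j c) *\<^sub>R simple_root j)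
      + (fst (weight_of c) $ i) *\<^sub>R simple_root i"
    by (simp add: sum.distrib)
  finally show ?thesis
    by (simp add: weight_refl_def weight_of_def)
qed

lemma weight_of_empty: "weight_of {} = fund_weight 0"
  by (simp add: weight_of_def node_count_def)

lemma weight_of_inj:
  assumes "core c" "core d" "weight_of c = weight_of d"
  shows "c = d"
proof -
  have "(\<lambda>j. real (node_count j c)) = (\<lambda>j. real (node_count j d))"
    using assms(3) by (intro simple_roots_independent) (simp add: weight_of_def)
  then show ?thesis
    using assms(1,2) by (intro core_eqI) (auto dest: fun_cong)
qed

lemma word_prod_Nil [simp]: "word_prod [] = id"
  and word_prod_Cons [simp]: "word_prod (i # is) = weight_refl i \<circ> word_prod is"
  by (simp_all add: word_prod_def)

lemma word_prod_append: "word_prod (is @ js) = word_prod is \<circ> word_prod js"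
  by (induction "is") auto

lemma core_word:
  assumes "core c"
  shows "core (foldr core_refl is c)"
    and "weight_of (foldr core_refl is c) = word_prod is (weight_of c)"
  using assms by (induction "is") (auto simp: core_core_refl weight_of_core_refl)

lemma core_word_rev:
  assumes "core c"
  shows "foldr core_refl (rev is) (foldr core_refl is c) = c"
  by (induction "is") (simp_all add: core_refl_idem core_word(1)[OF assms])

text \<open>The weight of the resulting core is the image of \<open>\<Lambda>\<^sub>0\<close> under the product of the word, and it
determines the core.\<close>

lemma core_act_word_prod: "core_act (word_prod is) {} = foldr core_refl is {}"
  unfolding core_act_def
proof (rule the_equality)
  fix d assume "\<exists>js. word_prod js = word_prod is \<and> foldr core_refl js {} = d"
  then obtain js where js: "word_prod js = word_prod is" "foldr core_refl js {} = d"
    by blast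
  have "foldr core_refl js {} = foldr core_refl is {}"
    by (rule weight_of_inj) (simp_all add: core_word[OF core_empty] js(1))
  then show "d = foldr core_refl is {}"
    using js by simp
qed blast

section \<open>The Weyl groups\<close>

lemma weight_refl_idem: "weight_refl i (weight_refl i x) = x"
proof -
  have "fst (weight_refl i x) $ i = - (fst x $ i)"
    by (simp add: weight_refl_def simple_root_def)
  then show ?thesis
    by (simp add: weight_refl_def[of i "weight_refl i x"]) (simp add: weight_refl_def)
qed

lemma word_prod_rev: "word_prod (rev is) \<circ> word_prod is = id"
  by (induction "is") (simp_all add: word_prod_append fun_eq_iff weight_refl_idem)

lemma word_prod_in_carrier: "word_prod is \<in> carrier (BijGroup UNIV)"
proof -
  have "word_prod is \<circ> word_prod (rev is) = id"
    using word_prod_rev[of "rev is"] by simp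
  then have "bij (word_prod is)"
    using word_prod_rev o_bij by blast
  then show ?thesis
    by (simp add: BijGroup_def Bij_def)
qed

lemma mult_word_prod:
  "word_prod is \<otimes>\<^bsub>BijGroup UNIV\<^esub> word_prod js = word_prod (is @ js)"
proof -
  have "word_prod is \<in> Bij UNIV" "word_prod js \<in> Bij UNIV"
    using word_prod_in_carrier by (auto simp: BijGroup_def)
  then show ?thesis
    by (simp add: BijGroup_def word_prod_append compose_def fun_eq_iff)
qed

lemma one_BijGroup_UNIV: "\<one>\<^bsub>BijGroup UNIV\<^esub> = id"
  by (simp add: BijGroup_def fun_eq_iff)

lemma inv_word_prod: "inv\<^bsub>BijGroup UNIV\<^esub> (word_prod is) = word_prod (rev is)"
proof (rule group.inv_equality[OF group_BijGroup])
  show "word_prod (rev is) \<otimes>\<^bsub>BijGroup UNIV\<^esub> word_prod is = \<one>\<^bsub>BijGroup UNIV\<^esub>"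
    by (simp add: mult_word_prod one_BijGroup_UNIV word_prod_append word_prod_rev)
qed (rule word_prod_in_carrier)+

lemma weyl_gens_words: "g \<in> weyl_gens X \<Longrightarrow> \<exists>is. g = word_prod is"
  by (cases X) (auto simp del: word_prod_Nil word_prod_Cons)

lemma weyl_group_words:
  assumes "w \<in> weyl_group X"
  shows "\<exists>is. w = word_prod is"
  using assms unfolding weyl_group_def
proof (induction rule: generate.induct)
  case one
  then show ?case
    by (metis one_BijGroup_UNIV word_prod_Nil)
next
  case (inv h)
  then show ?case
    using weyl_gens_words inv_word_prod by metis
next
  case (eng h1 h2)
  then show ?case
    using mult_word_prod by metis
qed (rule weyl_gens_words)

lemma weyl_group_mult:
  "word_prod is \<in> weyl_group X \<Longrightarrow> word_prod js \<in> weyl_group X \<Longrightarrow>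
    word_prod (is @ js) \<in> weyl_group X"
  unfolding weyl_group_def using generate.eng mult_word_prod by metis

lemma weyl_gens_carrier: "weyl_gens X \<subseteq> carrier (BijGroup UNIV)"
  using weyl_gens_words word_prod_in_carrier by blast

text \<open>The reflections \<open>s\<^sub>1, s\<^sub>3, s\<^sub>5\<close> commute, whence \<open>s\<^sub>1 s\<^sub>3 s\<^sub>5 = (s\<^sub>1 s\<^sub>5) s\<^sub>3\<close>.\<close>

lemma weyl_group_D4_3_subset: "weyl_group D4_3 \<subseteq> weyl_group A5_2"
proof -
  interpret group "BijGroup (UNIV :: weight set)"
    by (rule group_BijGroup)
  have "weight_refl 1 \<circ> weight_refl 3 = weight_refl 3 \<circ> weight_refl 1"
    "weight_refl 3 \<circ> weight_refl 5 = weight_refl 5 \<circ> weight_refl 3"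
    by (auto simp: fun_eq_iff weight_refl_def simple_root_def)
  then have "word_prod [1, 3, 5] = word_prod ([1, 5] @ [3])"
    by (simp add: fun_eq_iff)
  moreover have "word_prod ([1, 5] @ [3]) \<in> weyl_group A5_2"
    by (rule weyl_group_mult) (simp_all add: weyl_group_def generate.incl del: word_prod_Cons)
  moreover have "word_prod [0, 1, 5, 0] \<in> weyl_group A5_2" "word_prod [2, 4] \<in> weyl_group A5_2"
    by (simp_all add: weyl_group_def generate.incl del: word_prod_Cons)
  ultimately have "weyl_gens D4_3 \<subseteq> weyl_group A5_2"
    by (simp del: word_prod_Cons append_Cons append_Nil)
  moreover have "subgroup (weyl_group A5_2) (BijGroup UNIV)"
    unfolding weyl_group_def by (rule generate_is_subgroup) (rule weyl_gens_carrier)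
  ultimately show ?thesis
    unfolding weyl_group_def[of D4_3] by (rule generate_subgroup_incl)
qed

text \<open>Descent on the size. Write \<open>v\<^sub>i\<close> for the pairing of the weight of the core with \<open>\<alpha>\<^sub>i\<^sup>\<or>\<close>, so that \<open>s\<^sub>i\<close>
shrinks the core when \<open>v\<^sub>i < 0\<close>. The equations on the counts give \<open>v\<^sub>5 = v\<^sub>1\<close>, \<open>v\<^sub>4 = v\<^sub>2\<close> and
\<open>v\<^sub>3 = 2 v\<^sub>1\<close>. If \<open>v\<^sub>1 < 0\<close> or \<open>v\<^sub>2 < 0\<close>, then \<open>s\<^sub>1 s\<^sub>3 s\<^sub>5\<close> or \<open>s\<^sub>2 s\<^sub>4\<close> shrinks the core. Otherwise a
nonempty core has \<open>v\<^sub>0 < 0\<close>, and \<open>s\<^sub>0 s\<^sub>1 s\<^sub>5 s\<^sub>0\<close> shrinks it. All three preserve the equations.\<close>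

lemma symmetric_core_in_orbit:
  assumes "core c" and "node_count 1 c = node_count 5 c" "node_count 2 c = node_count 4 c"
    and "node_count 0 c + node_count 3 c = 2 * node_count 1 c"
  shows "\<exists>is. word_prod is \<in> weyl_group D4_3 \<and> foldr core_refl is {} = c"
  using assms
proof (induction "card c" arbitrary: c rule: less_induct)
  case less
  show ?case
  proof (cases "c = {}")
    case True
    have "word_prod [] \<in> weyl_group D4_3"
      unfolding weyl_group_def word_prod_Nil one_BijGroup_UNIV[symmetric] by (rule generate.one)
    then show ?thesis
      using True by (intro exI[of _ "[]"]) simp
  next
    case False
    define a where "a i = int (node_count i c)" for i
    have sym: "a 1 = a 5" "a 2 = a 4" "a 0 + a 3 = 2 * a 1"
      using less.prems by (simp_all add: a_def)
    have size: "int (card d) = int (node_count 0 d) + int (node_count 1 d) + int (node_count 2 d)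
        + int (node_count 3 d) + int (node_count 4 d) + int (node_count 5 d)" if "core d" for d
      using that by (simp add: core_def is_partition_def card_eq_sum_node_count sum_6)
    note step = node_count_core_refl core_core_refl less.prems(1) wrap_6
    let ?good = "\<lambda>d. node_count 1 d = node_count 5 d \<and> node_count 2 d = node_count 4 d \<and>
      node_count 0 d + node_count 3 d = 2 * node_count 1 d \<and> card d < card c"
    have good: "?good d" if "core d" "int (node_count 1 d) = int (node_count 5 d)"
        "int (node_count 2 d) = int (node_count 4 d)"
        "int (node_count 0 d) + int (node_count 3 d) = 2 * int (node_count 1 d)"
        "int (node_count 0 d) + int (node_count 1 d) + int (node_count 2 d)
        + int (node_count 3 d) + int (node_count 4 d) + int (node_count 5 d)
        < a 0 + a 1 + a 2 + a 3 + a 4 + a 5" for d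
      using that size[OF that(1)] size[OF less.prems(1)] unfolding a_def by linarith
    consider "a 0 + a 2 < 2 * a 1" | "a 1 + a 3 < 2 * a 2"
      | "2 * a 1 \<le> a 0 + a 2" "2 * a 2 \<le> a 1 + a 3" by linarith
    then have "\<exists>g \<in> {[0, 1, 5, 0], [2, 4], [1, 3, 5]}. ?good (foldr core_refl g c)"
    proof cases
      case 1
      define d where "d = foldr core_refl [1, 3, 5] c"
      have "int (node_count 0 d) = a 0" "int (node_count 1 d) = a 0 + a 2 - a 1"
        "int (node_count 2 d) = a 2" "int (node_count 3 d) = a 2 + a 4 - a 3"
        "int (node_count 4 d) = a 4" "int (node_count 5 d) = a 4 + a 0 - a 5"
        by (simp_all add: d_def a_def step)
      moreover have "core d"
        by (simp add: d_def step)
      ultimately have "?good d"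
        using sym 1 by (intro good) simp_all
      then show ?thesis
        unfolding d_def by blast
    next
      case 2
      define d where "d = foldr core_refl [2, 4] c"
      have "int (node_count 0 d) = a 0" "int (node_count 1 d) = a 1"
        "int (node_count 2 d) = a 1 + a 3 - a 2" "int (node_count 3 d) = a 3"
        "int (node_count 4 d) = a 3 + a 5 - a 4" "int (node_count 5 d) = a 5"
        by (simp_all add: d_def a_def step)
      moreover have "core d"
        by (simp add: d_def step)
      ultimately have "?good d"
        using sym 2 by (intro good) simp_all
      then show ?thesis
        unfolding d_def by blast
    next
      case 3
      \<comment> \<open>Here \<open>v\<^sub>0 < 0\<close> is the only possibility left.\<close>
      obtain i where i: "node_count i (core_refl i c) < node_count i c"
        using node_count_decreases[OF less.prems(1) False] by blast
      then have "1 + a 5 + a 1 < 2 * a 0"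
        using exhaust_6[of i] i node_count_core_refl[OF less.prems(1), of i i] 3 sym
        unfolding a_def by (auto simp: wrap_6)
      \<comment> \<open>Integrality turns \<open>2 a\<^sub>1 + 1 < 2 a\<^sub>0\<close> into the bound that makes the total decrease.\<close>
      then have "a 1 + 1 \<le> a 0"
        using sym by linarith
      define d where "d = foldr core_refl [0, 1, 5, 0] c"
      have "int (node_count 0 d) = 2 + a 2 + a 4 - a 0" "int (node_count 1 d) = 1 + a 5 + a 2 - a 0"
        "int (node_count 2 d) = a 2" "int (node_count 3 d) = a 3"
        "int (node_count 4 d) = a 4" "int (node_count 5 d) = 1 + a 1 + a 4 - a 0"
        by (simp_all add: d_def a_def step)
      moreover have "core d"
        by (simp add: d_def step)
      ultimately have "?good d"
        using sym 3 \<open>a 1 + 1 \<le> a 0\<close> by (intro good) simp_all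
      then show ?thesis
        unfolding d_def by blast
    qed
    then obtain g d where g: "g \<in> {[0, 1, 5, 0], [2, 4], [1, 3, 5]}" and d: "d = foldr core_refl g c"
      "node_count 1 d = node_count 5 d" "node_count 2 d = node_count 4 d"
      "node_count 0 d + node_count 3 d = 2 * node_count 1 d" "card d < card c"
      by blast
    have "core d"
      unfolding d(1) by (rule core_word(1)[OF less.prems(1)])
    then obtain js where js: "word_prod js \<in> weyl_group D4_3" "foldr core_refl js {} = d"
      using less.hyps d by blast
    have "word_prod g \<in> weyl_gens D4_3"
      using g by (auto simp del: word_prod_Cons)
    then have "word_prod (rev g) \<in> weyl_group D4_3"
      unfolding weyl_group_def inv_word_prod[symmetric] by (rule generate.inv)
    then have "word_prod (rev g @ js) \<in> weyl_group D4_3"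
      using js(1) by (rule weyl_group_mult)
    moreover have "foldr core_refl (rev g @ js) {} = c"
      using js(2) core_word_rev[OF less.prems(1), of g] d(1) by simp
    ultimately show ?thesis
      by blast
  qed
qed


section \<open>Atomic lengths\<close>

fun simple_root_coeff :: "twisted_type \<Rightarrow> real list \<Rightarrow> 6 \<Rightarrow> real" where
  "simple_root_coeff A5_2 cs j =
     (if j = 0 then 2 * cs ! 0 else if j = 1 \<or> j = 5 then cs ! 0 + cs ! 1
      else if j = 3 then 2 * cs ! 3 else cs ! 2)"
| "simple_root_coeff D4_3 cs j =
     (if j = 0 then 2 * cs ! 0 else if j = 1 \<or> j = 5 then cs ! 0 + cs ! 2
      else if j = 3 then 2 * cs ! 2 else cs ! 1)"

lemma sum_roots:
  "(\<Sum>i<length (roots X). (cs ! i) *\<^sub>R (roots X ! i)) =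
    (\<Sum>j\<in>UNIV. simple_root_coeff X cs j *\<^sub>R simple_root j)"
  by (cases X) (simp_all add: sum_6 roots_A5_2_def roots_D4_3_def numeral_eq_Suc scaleR_add_left
      scaleR_add_right mult.commute)

lemma simple_root_coeff_inj:
  assumes "length as = length (roots X)" "length bs = length (roots X)"
    and eq: "simple_root_coeff X as = simple_root_coeff X bs"
  shows "as = bs"
proof -
  have "simple_root_coeff X as j = simple_root_coeff X bs j" for j
    using eq by simp
  from this[of 0] this[of 1] this[of 2] this[of 3]
  have "\<forall>i<length (roots X). as ! i = bs ! i"
    by (cases X) (simp_all add: roots_A5_2_def roots_D4_3_def numeral_eq_Suc All_less_Suc)
  then show ?thesis
    using assms by (intro nth_equalityI) auto
qed

text \<open>The weight defect \<open>\<Lambda>\<^sub>0 - w \<Lambda>\<^sub>0\<close> is the same for all \<open>w\<close> carrying the empty core to \<open>c\<close>, as its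
coefficients in the simple roots are the node counts of \<open>c\<close>; and the twisted roots are linearly
independent.\<close>

lemma atomic_coeffs_eqI:
  assumes orbit: "word_prod is \<in> weyl_group X" "foldr core_refl is {} = c"
    and len: "length as = length (roots X)"
    and coeff: "\<And>j. simple_root_coeff X as j = real (node_count j c)"
  shows "atomic_coeffs X c = as"
  unfolding atomic_coeffs_def
proof (rule the_equality)
  have defect: "fund_weight 0 - word_prod js (fund_weight 0) =
      (\<Sum>j\<in>UNIV. real (node_count j c) *\<^sub>R simple_root j)" if "core_act (word_prod js) {} = c" for js
  proof -
    have "word_prod js (fund_weight 0) = weight_of c"
      using that core_word(2)[OF core_empty, of js] by (simp add: core_act_word_prod weight_of_empty)
    then show ?thesis
      by (simp add: weight_of_def)
  qed
  have act: "core_act (word_prod is) {} = c"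
    using orbit by (simp add: core_act_word_prod)
  then show "length as = length (roots X) \<and> (\<exists>w\<in>weyl_group X. c = core_act w {} \<and>
      fund_weight 0 - w (fund_weight 0) = (\<Sum>i<length (roots X). (as ! i) *\<^sub>R (roots X ! i)))"
    using orbit(1) len act by (intro conjI bexI[of _ "word_prod is"])
      (simp_all add: defect[OF act] sum_roots coeff)
  fix bs
  assume bs: "length bs = length (roots X) \<and> (\<exists>w\<in>weyl_group X. c = core_act w {} \<and>
      fund_weight 0 - w (fund_weight 0) = (\<Sum>i<length (roots X). (bs ! i) *\<^sub>R (roots X ! i)))"
  then obtain w where w: "w \<in> weyl_group X" "c = core_act w {}"
    "fund_weight 0 - w (fund_weight 0) = (\<Sum>i<length (roots X). (bs ! i) *\<^sub>R (roots X ! i))"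
    by blast
  obtain js where js: "w = word_prod js"
    using weyl_group_words[OF w(1)] by blast
  have "simple_root_coeff X bs = (\<lambda>j. real (node_count j c))"
    using w(3) defect[of js] w(2) unfolding js
    by (intro simple_roots_independent) (simp flip: sum_roots)
  also have "\<dots> = simple_root_coeff X as"
    using coeff by auto
  finally show "bs = as"
    using bs len by (intro simple_root_coeff_inj[of _ X]) simp_all
qed

theorem proposition5p15:
  fixes c :: diagram
  assumes "c \<in> cores6_g"
  shows "atomic_length D4_3 c = atomic_length A5_2 c - atomic_coeff A5_2 3 c \<and>
         atomic_length A5_2 c - atomic_coeff A5_2 3 c =
           1/2 * (real (card c) - real (node_count 0 c) - real (node_count 3 c))"
proof -
  define a where "a j = real (node_count j c)" for j
  have core: "core c"
    using assms core_cores6 by (auto simp: cores6_g_def)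
  have "of_nat 6 = (0 :: 6)"
    by simp
  then have sym: "node_count 1 c = node_count 5 c" "node_count 2 c = node_count 4 c"
    "node_count 0 c + node_count 3 c = 2 * node_count 1 c"
    using assms by (auto simp: cores6_g_def core_vector_def)
  then obtain "is" where orbit: "word_prod is \<in> weyl_group D4_3" "foldr core_refl is {} = c"
    using symmetric_core_in_orbit[OF core] by blast
  have a: "a 5 = a 1" "a 4 = a 2" "a 3 = 2 * a 1 - a 0"
    using sym by (simp_all add: a_def)
  have D: "atomic_coeffs D4_3 c = [a 0 / 2, a 2, a 1 - a 0 / 2]"
  proof (rule atomic_coeffs_eqI[OF orbit])
    show "simple_root_coeff D4_3 [a 0 / 2, a 2, a 1 - a 0 / 2] j = real (node_count j c)" for j
      using a exhaust_6[of j] by (auto simp flip: a_def)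
  qed (simp add: roots_D4_3_def)
  have A: "atomic_coeffs A5_2 c = [a 0 / 2, a 1 - a 0 / 2, a 2, a 3 / 2]"
  proof (rule atomic_coeffs_eqI)
    show "word_prod is \<in> weyl_group A5_2"
      using orbit(1) weyl_group_D4_3_subset by blast
    show "simple_root_coeff A5_2 [a 0 / 2, a 1 - a 0 / 2, a 2, a 3 / 2] j = real (node_count j c)" for j
      using a exhaust_6[of j] by (auto simp flip: a_def)
  qed (simp_all add: orbit(2) roots_A5_2_def)
  have "real (card c) = a 0 + a 1 + a 2 + a 3 + a 4 + a 5"
    using core by (simp add: core_def is_partition_def card_eq_sum_node_count sum_6 a_def)
  then show ?thesis
    using a by (simp add: atomic_length_def atomic_coeff_def D A roots_A5_2_def roots_D4_3_def
        numeral_eq_Suc flip: a_def)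
qed

end
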